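(* Let $\Gamma=\langle\alpha_1,\ldots,\alpha_k\rangle\subset\mathbb N^d$ be a full affine semigroup, let $A$ be the $d\times k$ matrix with columns $\alpha_1,\ldots,\alpha_k$, and fix $i\le k$. Let $H$ be the set of those minimal elements (with respect to the componentwise order $\le$) of $\{x\in\mathbb N^k: Ax\ge\alpha_i\}$ that satisfy $z_i=0$. If $H=\emptyset$ then $\mathsf t_i(\Gamma)=0$. Otherwise, for each $z\in H$ let $y^{(z)}$ be a minimizer of $y_1+\cdots+y_k$ over $\{y\in\mathbb N^k: Ay=Az,\ y\cdot z=0,\ y_i\ge1\}$; then $$\mathsf t_i(\Gamma)=\max\{|z|,|y^{(z)}|: z\in H\}.$$
   Context: An affine semigroup is a finitely generated submonoid of $\mathbb N^d$ with minimal generating set $\alpha_1,\ldots,\alpha_k$; it is full if $\mathrm G(\Gamma)\cap\mathbb N^d=\Gamma$, where $\mathrm G(\Gamma)$ is the subgroup of $\mathbb Z^d$ generated by $\Gamma$. Inequalities between vectors are componentwise. $\varphi_\Gamma(z)=Az$, $\mathsf Z(\gamma)=\varphi_\Gamma^{-1}(\gamma)$, $|z|=z_1+\cdots+z_k$, $\gcd(z,w)=(\min(z_l,w_l))_l$, $\mathrm{dist}(z,w)=\max(|z-\gcd(z,w)|,|w-\gcd(z,w)|)$. For $\gamma\in\Gamma$ with $\gamma-\alpha_i\in\Gamma$, $\mathsf t_i(\gamma)$ is the least $N\in\mathbb N\cup\{\infty\}$ such that for every $z\in\mathsf Z(\gamma)$ there is $w\in\mathsf Z(\gamma)$ with $w_i>0$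 and $\mathrm{dist}(z,w)\le N$; and $\mathsf t_i(\Gamma)=\sup\{\mathsf t_i(\gamma):\gamma-\alpha_i\in\Gamma\}$. *)

theory Defs
  imports "HOL-Analysis.Analysis" "HOL-Computational_Algebra.Group_Closure"
begin

definition is_submonoid :: "'a::monoid_add set \<Rightarrow> bool" where
  "is_submonoid S \<longleftrightarrow> 0 \<in> S \<and> (\<forall>x\<in>S. \<forall>y\<in>S. x + y \<in> S)"

text \<open>Injectivity: the columns enumerate the generating set without repetition.\<close>

definition minimal_generators :: "nat^'k^'d \<Rightarrow> (nat^'d) set \<Rightarrow> bool" where
  "minimal_generators A \<Gamma> \<longleftrightarrow>
     is_submonoid hull (columns A) = \<Gamma> \<and>
     inj (\<lambda>j. column j A) \<and>
     (\<forall>T. T \<subset> columns A \<longrightarrow> is_submonoid hull T \<noteq> \<Gamma>)"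

definition int_vec :: "nat^'d \<Rightarrow> int^'d" where
  "int_vec v = (\<chi> j. int (v $ j))"

definition full_semigroup :: "(nat^'d) set \<Rightarrow> bool" where
  "full_semigroup \<Gamma> \<longleftrightarrow> group_closure (int_vec ` \<Gamma>) \<inter> range int_vec = int_vec ` \<Gamma>"

definition factorizations :: "nat^'k^'d \<Rightarrow> nat^'d \<Rightarrow> (nat^'k) set" where
  "factorizations A \<gamma> = {z. A *v z = \<gamma>}"

definition vec_length :: "nat^'k \<Rightarrow> nat" where
  "vec_length z = (\<Sum>l\<in>UNIV. z $ l)"

definition vec_gcd :: "nat^'k \<Rightarrow> nat^'k \<Rightarrow> nat^'k" where
  "vec_gcd z w = (\<chi> l. min (z $ l) (w $ l))"

definition fact_dist :: "nat^'k \<Rightarrow> nat^'k \<Rightarrow> nat" where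
  "fact_dist z w = max (vec_length (z - vec_gcd z w)) (vec_length (w - vec_gcd z w))"

definition tame_elt :: "nat^'k^'d \<Rightarrow> 'k \<Rightarrow> nat^'d \<Rightarrow> enat" where
  "tame_elt A i \<gamma> =
     (LEAST N. \<forall>z\<in>factorizations A \<gamma>. \<exists>w\<in>factorizations A \<gamma>.
        w $ i > 0 \<and> enat (fact_dist z w) \<le> N)"

text \<open>Subtraction on \<open>nat^'d\<close> truncates, hence the guard \<open>column i A \<le> \<gamma>\<close>.\<close>

definition tame_degree :: "nat^'k^'d \<Rightarrow> (nat^'d) set \<Rightarrow> 'k \<Rightarrow> enat" where
  "tame_degree A \<Gamma> i =
     (SUP \<gamma> \<in> {\<gamma> \<in> \<Gamma>. column i A \<le> \<gamma> \<and> \<gamma> - column i A \<in> \<Gamma>}. tame_elt A i \<gamma>)"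

definition minimal_elements :: "'a::order set \<Rightarrow> 'a set" where
  "minimal_elements S = {x \<in> S. \<forall>y\<in>S. y \<le> x \<longrightarrow> y = x}"

end

theory Submission
  imports Defs
begin

text \<open>
  Let \<open>S\<close> be the set of all \<open>x\<close> with \<open>A x \<ge> \<alpha>\<^sub>i\<close>. By fullness, \<open>x \<in> S\<close> exactly when
  \<open>A x\<close> has a factorization using \<open>\<alpha>\<^sub>i\<close>. If \<open>z\<close> is minimal in \<open>S\<close> with \<open>z\<^sub>i = 0\<close>, every
  factorization \<open>w\<close> of \<open>A z\<close> using \<open>\<alpha>\<^sub>i\<close> has support disjoint from that of \<open>z\<close>, since a common
  atom could be cancelled from both; hence \<open>dist(z, w) = max(|z|, |w|)\<close>, which gives the lower
  bound. Conversely, an arbitrary factorization \<open>z\<close> of an admissible element lies above a minimal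
  \<open>m \<in> S\<close>; if \<open>z\<^sub>i = 0\<close>, then \<open>z - m + y\<^sup>(\<^sup>m\<^sup>)\<close> uses \<open>\<alpha>\<^sub>i\<close> and is at distance at most
  \<open>max(|m|, |y\<^sup>(\<^sup>m\<^sup>)|)\<close> from \<open>z\<close>. Finiteness of the minimal elements is Dickson's lemma.
\<close>

section \<open>Dickson's lemma via nondecreasing subsequences\<close>

lemma nat_seq_mono_subseq:
  fixes s :: "nat \<Rightarrow> nat"
  obtains r :: "nat \<Rightarrow> nat" where "strict_mono r" "mono (\<lambda>n. s (r n))"
proof -
  obtain r :: "nat \<Rightarrow> nat" where r: "strict_mono r" "monoseq (\<lambda>n. s (r n))"
    using seq_monosub[of s] by auto
  show thesis
  proof (cases "incseq (\<lambda>n. s (r n))")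
    case True
    with r that show ?thesis by blast
  next
    case False
    with r(2) have dec: "decseq (\<lambda>n. s (r n))"
      by (simp add: monoseq_iff)
    \<comment> \<open>A nonincreasing sequence of naturals is constant once it reaches its minimum
      \<open>v\<close>, so its tail from \<open>n0\<close> on is also nondecreasing.\<close>
    define v where "v = (LEAST v. v \<in> range (\<lambda>n. s (r n)))"
    have "v \<in> range (\<lambda>n. s (r n))"
      unfolding v_def by (rule LeastI) (rule rangeI)
    then obtain n0 where n0: "s (r n0) = v" by auto
    have ge: "v \<le> s (r n)" for n
      unfolding v_def by (rule Least_le) auto
    have "s (r (n0 + n)) = v" for n
      using ge[of "n0 + n"] decseqD[OF dec, of n0 "n0 + n"] n0 by simp
    then have "mono (\<lambda>n. s (r (n0 + n)))" by (simp add: mono_def)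
    moreover have "strict_mono (\<lambda>n. r (n0 + n))"
      using r(1) by (simp add: strict_mono_def)
    ultimately show ?thesis using that by blast
  qed
qed

text \<open>Coordinates are treated one at a time: each induction step thins out the sequence once
  more, and coordinates that are already monotone stay so along a further subsequence.\<close>

lemma nat_vec_mono_subseq:
  fixes f :: "nat \<Rightarrow> nat^'k"
  obtains r :: "nat \<Rightarrow> nat" where "strict_mono r" "mono (\<lambda>n. f (r n))"
proof -
  have "\<exists>r::nat\<Rightarrow>nat. strict_mono r \<and> (\<forall>l\<in>I. mono (\<lambda>n. f (r n) $ l))" if "finite I" for I :: "'k set"
    using that
  proof induction
    case empty
    show ?case by (rule exI[of _ id]) (simp add: strict_mono_def)
  next
    case (insert l I)
    then obtain r :: "nat \<Rightarrow> nat" where r: "strict_mono r" "\<forall>l\<in>I. mono (\<lambda>n. f (r n) $ l)" by blast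
    obtain q :: "nat \<Rightarrow> nat" where q: "strict_mono q" "mono (\<lambda>n. f (r (q n)) $ l)"
      using nat_seq_mono_subseq[of "\<lambda>n. f (r n) $ l"] by blast
    have "mono (\<lambda>n. f (r (q n)) $ j)" if "j \<in> I" for j
      using r(2) that q(1) by (auto simp: mono_def strict_mono_less_eq)
    with q r(1) show ?case
      by (intro exI[of _ "r \<circ> q"]) (auto simp: strict_mono_def)
  qed
  from this[of UNIV] show thesis
    using that by (auto simp: mono_def less_eq_vec_def)
qed

text \<open>Infinitely many minimal elements would form an injective sequence; a nondecreasing
  subsequence then yields two distinct comparable minimal elements.\<close>

lemma finite_minimal_elements_nat_vec:
  fixes S :: "(nat^'k) set"
  shows "finite (minimal_elements S)"
proof (rule ccontr)
  assume "infinite (minimal_elements S)"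
  then obtain f :: "nat \<Rightarrow> nat^'k" where f: "inj f" "range f \<subseteq> minimal_elements S"
    using infinite_countable_subset by blast
  obtain r :: "nat \<Rightarrow> nat" where r: "strict_mono r" "mono (\<lambda>n. f (r n))"
    by (rule nat_vec_mono_subseq)
  have "f (r 0) \<le> f (r 1)" using r(2) by (simp add: mono_def)
  moreover have "f (r 0) \<in> S" "f (r 1) \<in> minimal_elements S"
    using f(2) by (auto simp: minimal_elements_def)
  ultimately have "f (r 0) = f (r 1)" by (auto simp: minimal_elements_def)
  then have "r 0 = r 1" using f(1) by (simp add: inj_eq)
  then show False using strict_monoD[OF r(1), of 0 1] by simp
qed

section \<open>Length and minimal elements\<close>

lemma vec_length_mono: "x \<le> y \<Longrightarrow> vec_length x \<le> vec_length y"
  by (auto simp: vec_length_def less_eq_vec_def intro: sum_mono)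

lemma vec_length_strict_mono:
  assumes "x \<le> y" "x \<noteq> y"
  shows "vec_length x < vec_length y"
proof -
  obtain l where "x $ l \<noteq> y $ l" using assms(2) by (auto simp: vec_eq_iff)
  with assms(1) show ?thesis
    unfolding vec_length_def less_eq_vec_def
    by (intro sum_strict_mono_ex1) (auto simp: less_le)
qed

text \<open>An element of least length among those of \<open>S\<close> below \<open>x\<close> is
  minimal, because anything strictly below it would be shorter.\<close>

lemma minimal_element_below:
  fixes S :: "(nat^'k) set"
  assumes "x \<in> S"
  obtains m where "m \<in> minimal_elements S" "m \<le> x"
proof -
  obtain m where m: "m \<in> S" "m \<le> x"
    and least: "\<And>y. y \<in> S \<Longrightarrow> y \<le> x \<Longrightarrow> vec_length m \<le> vec_length y"
    using ex_has_least_nat[of "\<lambda>y. y \<in> S \<and> y \<le> x" x vec_length] assms by auto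
  have "y = m" if "y \<in> S" "y \<le> m" for y
    using vec_length_strict_mono[of y m] least[of y] that m(2) by force
  with m that show thesis by (auto simp: minimal_elements_def)
qed

section \<open>Truncated subtraction and unit vectors\<close>

lemma vec_nat_diff_add: "x \<le> y \<Longrightarrow> y - x + x = (y :: nat^'k)"
  by (simp add: vec_eq_iff less_eq_vec_def)

lemma vec_nat_diff_self_le: "y - x \<le> (y :: nat^'k)"
  by (simp add: less_eq_vec_def)

lemma matrix_vector_mult_nat_diff:
  fixes A :: "nat^'k^'d"
  assumes "x \<le> y"
  shows "A *v (y - x) + A *v x = A *v y"
  using vec_nat_diff_add[OF assms] by (metis matrix_vector_right_distrib)

lemma matrix_vector_mult_axis: "A *v axis i 1 = column i (A :: nat^'k^'d)"
  by (simp add: vec_eq_iff matrix_vector_mult_def column_def axis_def if_distrib cong: if_cong)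

lemma axis_le_iff: "axis i 1 \<le> (x :: nat^'k) \<longleftrightarrow> 0 < x $ i"
  by (auto simp: less_eq_vec_def axis_def)

lemma matrix_vector_mult_diff_axis:
  fixes A :: "nat^'k^'d"
  assumes "0 < x $ l"
  shows "A *v (x - axis l 1) + column l A = A *v x"
  using matrix_vector_mult_nat_diff[of "axis l 1" x A] assms
  by (simp only: axis_le_iff matrix_vector_mult_axis)

section \<open>Submonoids and fullness\<close>

lemma is_submonoid_sum:
  assumes "is_submonoid S" "\<And>j. j \<in> J \<Longrightarrow> f j \<in> S"
  shows "sum f J \<in> (S :: 'a::comm_monoid_add set)"
  using assms(2)
  by (induction J rule: infinite_finite_induct) (use assms(1) in \<open>auto simp: is_submonoid_def\<close>)

lemma is_submonoid_nat_scale: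
  assumes "is_submonoid S" "v \<in> S"
  shows "n *s v \<in> (S :: (nat^'d) set)"
proof (induction n)
  case 0
  have "0 *s v = 0" by (simp add: vec_eq_iff)
  then show ?case using assms(1) by (simp add: is_submonoid_def)
next
  case (Suc n)
  have "Suc n *s v = v + n *s v" by (simp add: vec_eq_iff)
  then show ?case using Suc assms by (simp add: is_submonoid_def)
qed

text \<open>Columns are the images of unit vectors, and \<open>A *v x\<close> is a sum of natural
  multiples of columns, so it lies in every submonoid containing them.\<close>

lemma submonoid_hull_columns: "is_submonoid hull (columns A) = range ((*v) (A :: nat^'k^'d))"
proof (rule hull_unique)
  show "columns A \<subseteq> range ((*v) A)"
    by (auto simp: columns_def simp flip: matrix_vector_mult_axis)
  show "is_submonoid (range ((*v) A))"
    unfolding is_submonoid_def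
    by (auto simp flip: matrix_vector_right_distrib intro: range_eqI[of _ _ 0])
  fix T assume T: "columns A \<subseteq> T" "is_submonoid T"
  show "range ((*v) A) \<subseteq> T"
    unfolding matrix_mult_sum
    using T by (auto simp: columns_def intro!: is_submonoid_sum is_submonoid_nat_scale)
qed

text \<open>Since \<open>\<alpha> \<le> \<beta>\<close>, the truncated difference agrees with the
  integer one, which lies in the generated group; fullness brings it back into
  \<open>\<Gamma>\<close>.\<close>

lemma full_semigroup_diff:
  fixes \<Gamma> :: "(nat^'d) set"
  assumes "full_semigroup \<Gamma>" "\<alpha> \<in> \<Gamma>" "\<beta> \<in> \<Gamma>" "\<alpha> \<le> \<beta>"
  shows "\<beta> - \<alpha> \<in> \<Gamma>"
proof -
  have eq: "int_vec (\<beta> - \<alpha>) = int_vec \<beta> - int_vec \<alpha>"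
    using assms(4) by (auto simp: int_vec_def vec_eq_iff less_eq_vec_def of_nat_diff)
  have "int_vec (\<beta> - \<alpha>) \<in> group_closure (int_vec ` \<Gamma>)"
    unfolding eq using assms(2,3) by (intro group_closure.diff group_closure.base) auto
  then have "int_vec (\<beta> - \<alpha>) \<in> int_vec ` \<Gamma>"
    using assms(1) unfolding full_semigroup_def by blast
  moreover have "inj (int_vec :: nat^'d \<Rightarrow> int^'d)" by (auto simp: inj_def int_vec_def vec_eq_iff)
  ultimately show ?thesis by (simp add: inj_image_mem_iff)
qed

text \<open>Fullness makes \<open>A *v x - column i A\<close> factorable; adding the unit vector at
  \<open>i\<close> to such a factorization gives \<open>w\<close>.\<close>

lemma full_semigroup_factorization:
  assumes "full_semigroup (range ((*v) (A :: nat^'k^'d)))" "column i A \<le> A *v x"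
  obtains w where "A *v w = A *v x" "0 < w $ i"
proof -
  have "A *v x - column i A \<in> range ((*v) A)"
    using assms by (intro full_semigroup_diff) (auto simp flip: matrix_vector_mult_axis)
  then obtain u where u: "A *v x - column i A = A *v u" by auto
  have "A *v (u + axis i 1) = A *v x"
    using vec_nat_diff_add[OF assms(2)]
    by (simp add: matrix_vector_right_distrib matrix_vector_mult_axis u del: One_nat_def)
  then show thesis by (rule that) simp
qed

section \<open>Minimal elements and distances\<close>

lemma column_le_matrix_vector_mult:
  fixes A :: "nat^'k^'d"
  assumes "0 < w $ i"
  shows "column i A \<le> A *v w"
  unfolding matrix_vector_mult_diff_axis[OF assms, of A, symmetric] by (simp add: less_eq_vec_def)

lemma minimal_disjoint_support:
  fixes A :: "nat^'k^'d"
  assumes z: "z \<in> minimal_elements {x. column i A \<le> A *v x}" "z $ i = 0"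
    and w: "A *v w = A *v z" "0 < w $ i"
  shows "w $ l = 0 \<or> z $ l = 0"
proof (rule ccontr)
  assume "\<not> ?thesis"
  then have pos: "0 < w $ l" "0 < z $ l" by auto
  with z(2) have "l \<noteq> i" by auto
  define z' w' where "z' = z - axis l 1" and "w' = w - axis l 1"
  have "A *v z' + column l A = A *v z" "A *v w' + column l A = A *v w"
    unfolding z'_def w'_def by (intro matrix_vector_mult_diff_axis pos)+
  with w(1) have "A *v z' = A *v w'" by (metis add_right_cancel)
  \<comment> \<open>The cancelled atom is not the one at \<open>i\<close>, because \<open>z\<close>
    avoids \<open>i\<close>. Hence \<open>w'\<close> still uses \<open>i\<close> and keeps the
    common value above \<open>column i A\<close>, so \<open>z'\<close> contradicts minimality of
    \<open>z\<close>.\<close>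
  moreover have "0 < w' $ i" using w(2) \<open>l \<noteq> i\<close> by (simp add: w'_def axis_def)
  ultimately have "column i A \<le> A *v z'" using column_le_matrix_vector_mult by metis
  moreover have "z' \<le> z" unfolding z'_def by (rule vec_nat_diff_self_le)
  ultimately have "z' = z" using z(1) by (auto simp: minimal_elements_def)
  then have "z' $ l = z $ l" by simp
  then show False using pos(2) by (simp add: z'_def)
qed

lemma fact_dist_disjoint:
  assumes "\<And>l. w $ l = 0 \<or> z $ l = 0"
  shows "fact_dist z w = max (vec_length z) (vec_length w)"
proof -
  have "min (z $ l) (w $ l) = 0" for l
    using assms[of l] by auto
  then have "vec_gcd z w = 0"
    by (simp add: vec_gcd_def vec_eq_iff)
  moreover have "v - 0 = v" for v :: "nat^'a" by (simp add: vec_eq_iff)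
  ultimately show ?thesis by (simp add: fact_dist_def)
qed

text \<open>Both vectors contain \<open>z - m\<close>, so removing their gcd leaves at most
  \<open>m\<close> of the first and at most \<open>y\<close> of the second.\<close>

lemma fact_dist_exchange_le:
  assumes "m \<le> z"
  shows "fact_dist z (z - m + y) \<le> max (vec_length m) (vec_length y)"
proof -
  have "z - vec_gcd z (z - m + y) \<le> m" "z - m + y - vec_gcd z (z - m + y) \<le> y"
    using assms by (auto simp: vec_gcd_def less_eq_vec_def min_def)
  then show ?thesis unfolding fact_dist_def by (meson max.mono vec_length_mono)
qed

lemma fact_dist_self: "fact_dist z z = 0"
  by (simp add: fact_dist_def vec_gcd_def vec_length_def)

section \<open>Bounds for the tame degree\<close>

lemma tame_elt_leI:
  assumes "\<And>z. A *v z = \<gamma> \<Longrightarrow> \<exists>w. A *v w = \<gamma> \<and> 0 < w $ i \<and> enat (fact_dist z w) \<le> N"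
  shows "tame_elt A i \<gamma> \<le> N"
  unfolding tame_elt_def by (rule Least_le) (use assms in \<open>auto simp: factorizations_def\<close>)

lemma tame_elt_geI:
  assumes "A *v w0 = \<gamma>" "0 < w0 $ i" "A *v z = \<gamma>"
    and "\<And>w. A *v w = \<gamma> \<Longrightarrow> 0 < w $ i \<Longrightarrow> N \<le> enat (fact_dist z w)"
  shows "N \<le> tame_elt A i \<gamma>"
proof -
  let ?P = "\<lambda>N. \<forall>z\<in>factorizations A \<gamma>. \<exists>w\<in>factorizations A \<gamma>.
        w $ i > 0 \<and> enat (fact_dist z w) \<le> N"
  \<comment> \<open>The witness \<open>w0\<close> makes \<open>\<infinity>\<close> an admissible
    bound, so the set under \<open>LEAST\<close> is nonempty and its least element satisfies the
    defining property.\<close>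
  have "?P \<infinity>" using assms(1,2) by (auto simp: factorizations_def)
  then have "?P (tame_elt A i \<gamma>)" unfolding tame_elt_def by (rule LeastI)
  with assms(3) obtain w where "A *v w = \<gamma>" "0 < w $ i" "enat (fact_dist z w) \<le> tame_elt A i \<gamma>"
    by (auto simp: factorizations_def)
  with assms(4)[of w] show ?thesis by simp
qed

text \<open>Reduces an upper bound to minimal elements avoiding \<open>i\<close>. With
  \<open>N\<close> arbitrary it serves both the maximum over \<open>H\<close> and, the hypothesis
  then being vacuous, the value \<open>0\<close> for empty \<open>H\<close>.\<close>

lemma tame_degree_leI:
  fixes A :: "nat^'k^'d"
  assumes "\<And>z. z \<in> minimal_elements {x. column i A \<le> A *v x} \<Longrightarrow> z $ i = 0 \<Longrightarrow>
    \<exists>y. A *v y = A *v z \<and> 0 < y $ i \<and> enat (max (vec_length z) (vec_length y)) \<le> N"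
  shows "tame_degree A \<Gamma> i \<le> N"
  unfolding tame_degree_def
proof (intro SUP_least tame_elt_leI)
  fix \<gamma> z assume \<gamma>: "\<gamma> \<in> {\<gamma> \<in> \<Gamma>. column i A \<le> \<gamma> \<and> \<gamma> - column i A \<in> \<Gamma>}" and z: "A *v z = \<gamma>"
  show "\<exists>w. A *v w = \<gamma> \<and> 0 < w $ i \<and> enat (fact_dist z w) \<le> N"
  proof (cases "0 < z $ i")
    case True
    with z show ?thesis by (intro exI[of _ z]) (simp add: fact_dist_self flip: zero_enat_def)
  next
    case False
    from \<gamma> z have "z \<in> {x. column i A \<le> A *v x}" by simp
    then obtain m where m: "m \<in> minimal_elements {x. column i A \<le> A *v x}" "m \<le> z"
      by (rule minimal_element_below)
    have "m $ i = 0" using m(2) False by (metis less_eq_vec_def le_zero_eq not_gr_zero)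
    with assms m(1) obtain y where y: "A *v y = A *v m" "0 < y $ i"
      "enat (max (vec_length m) (vec_length y)) \<le> N" by blast
    have "A *v (z - m + y) = \<gamma>"
      using matrix_vector_mult_nat_diff[OF m(2), of A] y(1) z
      by (simp add: matrix_vector_right_distrib)
    moreover have "0 < (z - m + y) $ i" using y(2) by simp
    moreover have "enat (fact_dist z (z - m + y)) \<le> N"
      using fact_dist_exchange_le[OF m(2), of y] y(3) by (meson enat_ord_simps(1) order_trans)
    ultimately show ?thesis by blast
  qed
qed

section \<open>The tame degree as a maximum over \<open>H\<close>\<close>

theorem theorem5p11:
  fixes \<Gamma> :: "(nat^'d) set" and A :: "nat^'k^'d" and i :: 'k and H :: "(nat^'k) set"
  assumes "minimal_generators A \<Gamma>"
    and "full_semigroup \<Gamma>"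
    and "H = {z \<in> minimal_elements {x. column i A \<le> A *v x}. z $ i = 0}"
  shows "(H = {} \<longrightarrow> tame_degree A \<Gamma> i = 0) \<and>
    (H \<noteq> {} \<longrightarrow>
      finite H \<and>
      (\<forall>z\<in>H. \<exists>y. is_arg_min vec_length
         (\<lambda>y. A *v y = A *v z \<and> (\<Sum>l\<in>UNIV. y $ l * z $ l) = 0 \<and> 1 \<le> y $ i) y) \<and>
      (\<forall>y :: nat^'k \<Rightarrow> nat^'k.
         (\<forall>z\<in>H. is_arg_min vec_length
            (\<lambda>y. A *v y = A *v z \<and> (\<Sum>l\<in>UNIV. y $ l * z $ l) = 0 \<and> 1 \<le> y $ i) (y z)) \<longrightarrow>
         tame_degree A \<Gamma> i =
           enat (Max (vec_length ` H \<union> (\<lambda>z. vec_length (y z)) ` H))))"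
proof -
  have \<Gamma>: "\<Gamma> = range ((*v) A)"
    using assms(1) by (simp add: minimal_generators_def submonoid_hull_columns)
  have H: "z \<in> minimal_elements {x. column i A \<le> A *v x}" "z $ i = 0" "column i A \<le> A *v z"
    if "z \<in> H" for z
    using that by (auto simp: assms(3) minimal_elements_def)
  define Q where "Q z y \<longleftrightarrow>
    A *v y = A *v z \<and> (\<Sum>l\<in>UNIV. y $ l * z $ l) = 0 \<and> 1 \<le> y $ i" for z y :: "nat^'k"
  \<comment> \<open>For \<open>z\<close> in \<open>H\<close> the orthogonality condition is
    automatic, so the minimizers range over all factorizations of \<open>A *v z\<close> that use
    \<open>i\<close>.\<close>
  have Q_iff: "Q z y \<longleftrightarrow> A *v y = A *v z \<and> 0 < y $ i" if "z \<in> H" for z y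
    using minimal_disjoint_support[OF H(1,2)[OF that], of y] by (force simp: Q_def)
  have Q_ex: "\<exists>y. Q z y" if "z \<in> H" for z
    using full_semigroup_factorization[of A i z] assms(2) H(3)[OF that] Q_iff[OF that]
    unfolding \<Gamma> by metis
  have fin: "finite H"
    unfolding assms(3) by (rule finite_subset[OF _ finite_minimal_elements_nat_vec]) auto
  have "\<exists>y. is_arg_min vec_length (Q z) y" if "z \<in> H" for z
    using Q_ex[OF that] ex_has_least_nat[of "Q z" _ vec_length]
    by (auto simp: is_arg_min_linorder)
  moreover have "tame_degree A \<Gamma> i = enat (Max (vec_length ` H \<union> (\<lambda>z. vec_length (y z)) ` H))"
    if "H \<noteq> {}" and y: "\<forall>z\<in>H. is_arg_min vec_length (Q z) (y z)" for y
  proof (rule antisym)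
    let ?M = "vec_length ` H \<union> (\<lambda>z. vec_length (y z)) ` H"
    have M: "vec_length z \<le> Max ?M" "vec_length (y z) \<le> Max ?M" if "z \<in> H" for z
      using fin that by (auto intro!: Max_ge)
    have Qy: "Q z (y z)" "\<And>w. Q z w \<Longrightarrow> vec_length (y z) \<le> vec_length w" if "z \<in> H" for z
      using y that by (auto simp: is_arg_min_linorder)
    show "tame_degree A \<Gamma> i \<le> enat (Max ?M)"
    proof (rule tame_degree_leI)
      fix z assume "z \<in> minimal_elements {x. column i A \<le> A *v x}" "z $ i = 0"
      then have z: "z \<in> H" by (simp add: assms(3))
      show "\<exists>y. A *v y = A *v z \<and> 0 < y $ i \<and> enat (max (vec_length z) (vec_length y)) \<le> enat (Max ?M)"
        using Qy(1)[OF z] Q_iff[OF z] M[OF z] by (intro exI[of _ "y z"]) simp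
    qed
    have bound: "enat (max (vec_length z) (vec_length (y z))) \<le> tame_degree A \<Gamma> i" if z: "z \<in> H" for z
    proof -
      \<comment> \<open>The factorization \<open>z\<close> itself forces the bound: its distance to
        any \<open>w\<close> using \<open>i\<close> is the larger of the two lengths, and
        \<open>w\<close> is at least as long as \<open>y z\<close>.\<close>
      have "enat (max (vec_length z) (vec_length (y z))) \<le> tame_elt A i (A *v z)"
      proof (rule tame_elt_geI)
        show "A *v y z = A *v z" "0 < y z $ i" using Qy(1)[OF z] Q_iff[OF z] by auto
        fix w assume w: "A *v w = A *v z" "0 < w $ i"
        then have "vec_length (y z) \<le> vec_length w" using Qy(2)[OF z] Q_iff[OF z] by blast
        then show "enat (max (vec_length z) (vec_length (y z))) \<le> enat (fact_dist z w)"
          using fact_dist_disjoint[of w z] minimal_disjoint_support[OF H(1,2)[OF z] w] by simp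
      qed simp
      also have "\<dots> \<le> tame_degree A \<Gamma> i"
        unfolding tame_degree_def
      proof (rule SUP_upper)
        have "column i A \<in> \<Gamma>" "A *v z \<in> \<Gamma>" by (auto simp: \<Gamma> simp flip: matrix_vector_mult_axis)
        then show "A *v z \<in> {\<gamma> \<in> \<Gamma>. column i A \<le> \<gamma> \<and> \<gamma> - column i A \<in> \<Gamma>}"
          using H(3)[OF z] full_semigroup_diff[OF assms(2)] by simp
      qed
      finally show ?thesis .
    qed
    \<comment> \<open>The maximum over the finite nonempty set is attained at a single
      \<open>z\<close>, so \<open>bound\<close> for that \<open>z\<close> suffices.\<close>
    have "Max ?M \<in> ?M" using fin \<open>H \<noteq> {}\<close> by (intro Max_in) auto
    then obtain z where "z \<in> H" "Max ?M \<le> max (vec_length z) (vec_length (y z))" by fastforce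
    then show "enat (Max ?M) \<le> tame_degree A \<Gamma> i"
      using bound[of z] by (meson enat_ord_simps(1) order_trans)
  qed
  moreover have "tame_degree A \<Gamma> i = 0" if "H = {}"
  proof -
    have "tame_degree A \<Gamma> i \<le> 0"
      by (rule tame_degree_leI) (use that assms(3) in auto)
    then show ?thesis by simp
  qed
  ultimately show ?thesis using fin unfolding Q_def by blast
qed

end
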